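(* Let $H$ be a real Hilbert space, $K\ge 2$, and let $A_1,\dots,A_K\subset H$ be closed convex sets with $A_1\cap\dots\cap A_K=\{0\}$. Let $i(n)\in\{1,\dots,K\}$, $n=1,2,\dots$, be a sequence containing each $k\in\{1,\dots,K\}$ infinitely often, let $x_0\in H$, let $x_n=P_{i(n)}x_{n-1}$ for $n\ge 1$, and let $W$ be the set of all partial weak limits of $\{x_n\}$. If $W\ne\{0\}$, then there exist two different elements $w,w'\in W$ and indices $n_1<m_1<n_2<m_2<\dots$ such that $x_{n_k}\rightharpoonup w$ and $x_{m_k}\rightharpoonup w'$ weakly as $k\to\infty$, and $i(n)\in J(w)\cap J(w')$ for every integer $n\in\bigcup_k (n_k,m_k)$. Consequently, for these $w,w'$: (i) $\langle w'-w,a\rangle\ge 0$ for every $a\in A_{J(w)}$; (ii) $\langle w'-w,b\rangle\ge 0$ for every $b\in A_{J(w')}$.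
   Context: $\langle\cdot,\cdot\rangle$ and $|\cdot|$ denote the scalar product and the norm of $H$. $P_i$ denotes the metric (nearest point) projection of $H$ onto $A_i$. A partial weak limit of $\{x_n\}$ is the weak limit of some subsequence of $\{x_n\}$. For $J\subset\{1,\dots,K\}$, $A_J=\bigcap_{j\in J}A_j$. For $w\in W$, $J(w)$ is the maximal subset of $\{1,\dots,K\}$ such that $w\in A_{J(w)}$, i.e. $J(w)=\{j: w\in A_j\}$. $(n_k,m_k)$ denotes the open interval. *)

theory Defs
  imports "HOL-Analysis.Analysis"
begin

text \<open>
  The library's \<open>closest_point\<close> requires class \<open>heine_borel\<close>, which forces finite dimension, so
  the metric projection is defined here. The nearest point exists and is unique whenever
  \<open>S\<close> is a nonempty closed convex subset of a Hilbert space.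
\<close>

definition metric_proj :: "'a::real_inner set \<Rightarrow> 'a \<Rightarrow> 'a" where
  "metric_proj S x = (THE p. p \<in> S \<and> (\<forall>y\<in>S. dist x p \<le> dist x y))"

definition weakly_converges :: "(nat \<Rightarrow> 'a::real_inner) \<Rightarrow> 'a \<Rightarrow> bool" where
  "weakly_converges x w \<longleftrightarrow> (\<forall>y. (\<lambda>n. inner (x n) y) \<longlonglongrightarrow> inner w y)"

definition partial_weak_limits :: "(nat \<Rightarrow> 'a::real_inner) \<Rightarrow> 'a set" where
  "partial_weak_limits x = {w. \<exists>r. strict_mono r \<and> weakly_converges (x \<circ> r) w}"

definition index_set :: "nat \<Rightarrow> (nat \<Rightarrow> 'a set) \<Rightarrow> 'a \<Rightarrow> nat set" where
  "index_set K A w = {j \<in> {1..K}. w \<in> A j}"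

end

theory Submission
  imports Defs "HOL-Library.Diagonal_Subsequence"
begin

text \<open>
  Projecting \<open>x\<close> onto a closed convex set containing \<open>a\<close> yields a point \<open>p\<close> with
  \<open>\<parallel>p\<parallel>\<^sup>2 - \<parallel>x\<parallel>\<^sup>2 + \<parallel>p - x\<parallel>\<^sup>2 \<le> 2\<langle>p - x, a\<rangle>\<close> (\<open>metric_proj_step\<close>). Everything about the orbit comes
  from this inequality. With \<open>a = 0\<close> it says that the norms of the orbit decrease, hence
  converge, and that consecutive points get arbitrarily close.

  The orbit is therefore bounded, and a bounded sequence in a Hilbert space has a weakly
  convergent subsequence (\<open>bounded_weakly_convergent_subsequence\<close>). For each index \<open>k\<close>
  this applies to the times at which the \<open>k\<close>-th set is projected on, so \<open>W\<close> meets every set. If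
  \<open>W\<close> had just one element, that element would lie in all sets and would be \<open>0\<close>; hence \<open>W\<close> has
  two different elements, and the orbit oscillates between them infinitely often.

  Among all oscillations between two different weak limits, choose one for which the set \<open>I\<close> of
  indices used strictly in between is as small as possible. Suppose \<open>j \<in> I\<close>. Stop every excursion
  when \<open>j\<close> is used for the first time and pass to a weak limit \<open>v\<close> of the stopping points. If
  \<open>v\<close> differed from the starting limit \<open>w\<close>, the shortened excursions from \<open>w\<close> to \<open>v\<close>
  would avoid \<open>j\<close>, against minimality. So \<open>v = w\<close>, and since \<open>v\<close> lies in the \<open>j\<close>-th set, so does
  \<open>w\<close>. Starting at the last use of \<open>j\<close> shows the same for \<open>w'\<close>.

  Finally, let \<open>a\<close> lie in every set with index in \<open>I\<close>. Summing the inequality over an excursion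
  bounds \<open>2\<langle>x\<^sub>p - x\<^sub>n, a\<rangle>\<close> from below by \<open>\<parallel>x\<^sub>p\<parallel>\<^sup>2 - \<parallel>x\<^sub>n\<parallel>\<^sup>2\<close>, which tends to \<open>0\<close>; the limit is
  \<open>\<langle>w' - w, a\<rangle> \<ge> 0\<close>.
\<close>

section \<open>Nearest points in Hilbert space\<close>

text \<open>
  One argument serves two purposes: a constant family gives existence of the metric projection,
  a decreasing bounded family gives a common point, which for the convex hulls of the tails of a
  sequence is the candidate for its weak limit. If \<open>d\<close> is the limit of the distances from \<open>x\<close> to \<open>C n\<close>,
  the parts of \<open>C n\<close> at distance almost \<open>d\<close> from \<open>x\<close> have diameters tending to \<open>0\<close>, because by
  the parallelogram law two far-apart points would have a midpoint too close to \<open>x\<close>.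
\<close>

lemma nearest_point_of_nested_convex:
  fixes C :: "nat \<Rightarrow> 'a::{real_inner, complete_space} set"
  assumes closed: "\<And>n. closed (C n)" and convex: "\<And>n. convex (C n)"
    and ne: "\<And>n. C n \<noteq> {}"
    and decreasing: "\<And>m n. m \<le> n \<Longrightarrow> C n \<subseteq> C m"
    and bound: "\<And>n. infdist x (C n) \<le> B"
  obtains z where "\<And>n. z \<in> C n" "\<And>y. (\<And>n. y \<in> C n) \<Longrightarrow> dist x z \<le> dist x y"
proof -
  define \<delta> where "\<delta> n = infdist x (C n)" for n
  have "incseq \<delta>"
    unfolding incseq_def \<delta>_def by (simp add: decreasing infdist_mono ne)
  then obtain d where d: "\<delta> \<longlonglongrightarrow> d" "\<And>n. \<delta> n \<le> d"
    using bound incseq_convergent[of \<delta> B] unfolding \<delta>_def by blast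
  define \<rho> where "\<rho> n = d + inverse (real (Suc n))" for n
  have \<rho>: "\<rho> \<longlonglongrightarrow> d"
    unfolding \<rho>_def using tendsto_add[OF tendsto_const LIMSEQ_inverse_real_of_nat] by force
  define S where "S n = C n \<inter> cball x (\<rho> n)" for n
  obtain z where z: "\<And>n. z \<in> S n"
  proof (rule decreasing_closed_nest[of S])
    show "closed (S n)" for n
      by (simp add: S_def closed closed_Int)
    show "S n \<noteq> {}" for n
    proof -
      have "infdist x (C n) < \<rho> n"
        using d(2)[of n] inverse_positive_iff_positive[of "real (Suc n)"]
        unfolding \<rho>_def \<delta>_def by linarith
      then have "(INF a\<in>C n. dist x a) < \<rho> n"
        by (simp add: infdist_notempty ne)
      then obtain a where "a \<in> C n" "dist x a < \<rho> n"
        using cInf_lessD[of "dist x ` C n"] ne[of n] by blast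
      then show ?thesis
        by (auto simp: S_def intro!: exI[of _ a])
    qed
    show "S n \<subseteq> S m" if "m \<le> n" for m n
    proof -
      have "\<rho> n \<le> \<rho> m"
        using that by (simp add: \<rho>_def)
      then show ?thesis
        using decreasing[OF that] by (auto simp: S_def)
    qed
    show "\<exists>n. \<forall>u\<in>S n. \<forall>v\<in>S n. dist u v < e" if "e > 0" for e
    proof -
      have "(\<lambda>n. 4 * (\<rho> n)\<^sup>2 - 4 * (\<delta> n)\<^sup>2) \<longlonglongrightarrow> 4 * d\<^sup>2 - 4 * d\<^sup>2"
        by (intro tendsto_intros \<rho> d)
      then have "\<forall>\<^sub>F n in sequentially. 4 * (\<rho> n)\<^sup>2 - 4 * (\<delta> n)\<^sup>2 < e\<^sup>2"
        using that by (auto intro: order_tendstoD(2))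
      then obtain n where n: "4 * (\<rho> n)\<^sup>2 - 4 * (\<delta> n)\<^sup>2 < e\<^sup>2"
        by (auto simp: eventually_sequentially)
      have "dist u v < e" if u: "u \<in> S n" and v: "v \<in> S n" for u v
      proof -
        define c where "c = (1/2) *\<^sub>R u + (1/2) *\<^sub>R v"
        have "c \<in> C n"
          using u v convexD[OF convex, of u n v "1/2" "1/2"] by (simp add: S_def c_def)
        then have "\<delta> n \<le> dist x c"
          unfolding \<delta>_def by (rule infdist_le)
        then have "(\<delta> n)\<^sup>2 \<le> (dist x c)\<^sup>2"
          by (simp add: \<delta>_def infdist_nonneg power_mono)
        moreover have "(dist x u)\<^sup>2 \<le> (\<rho> n)\<^sup>2" "(dist x v)\<^sup>2 \<le> (\<rho> n)\<^sup>2"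
          using u v by (auto simp: S_def intro!: power_mono)
        moreover have "(dist u v)\<^sup>2 = 2 * (dist x u)\<^sup>2 + 2 * (dist x v)\<^sup>2 - 4 * (dist x c)\<^sup>2"
          unfolding dist_norm c_def power2_norm_eq_inner
          by (simp add: inner_simps inner_commute algebra_simps)
        ultimately have "(dist u v)\<^sup>2 < e\<^sup>2"
          using n by linarith
        then show ?thesis
          using \<open>e > 0\<close> by (meson less_imp_le power2_less_imp_less)
      qed
      then show ?thesis by blast
    qed
  qed blast
  show thesis
  proof
    show "z \<in> C n" for n
      using z by (simp add: S_def)
    fix y assume y: "\<And>n. y \<in> C n"
    have "dist x z \<le> d"
      using z by (intro LIMSEQ_le_const[OF \<rho>]) (auto simp: S_def)
    also have "d \<le> dist x y"
      using y by (intro LIMSEQ_le_const2[OF d(1)]) (auto simp: \<delta>_def intro: infdist_le)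
    finally show "dist x z \<le> dist x y" .
  qed
qed

lemma metric_proj_closest:
  fixes S :: "'a::{real_inner, complete_space} set"
  assumes "closed S" "convex S" "S \<noteq> {}"
  shows "metric_proj S x \<in> S \<and> (\<forall>y\<in>S. dist x (metric_proj S x) \<le> dist x y)"
proof -
  obtain z where "z \<in> S" "\<And>y. y \<in> S \<Longrightarrow> dist x z \<le> dist x y"
    using nearest_point_of_nested_convex[of "\<lambda>_. S" x "infdist x S"] assms by auto
  then have "\<exists>!p. p \<in> S \<and> (\<forall>y\<in>S. dist x p \<le> dist x y)"
    using any_closest_point_unique[OF assms(2,1)] by blast
  then show ?thesis
    unfolding metric_proj_def by (rule theI')
qed

lemma metric_proj_in:
  fixes S :: "'a::{real_inner, complete_space} set"
  assumes "closed S" "convex S" "S \<noteq> {}"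
  shows "metric_proj S x \<in> S"
  using metric_proj_closest[OF assms] by blast

lemma metric_proj_inner_le_0:
  fixes S :: "'a::{real_inner, complete_space} set"
  assumes "closed S" "convex S" "a \<in> S"
  shows "inner (x - metric_proj S x) (a - metric_proj S x) \<le> 0"
  using any_closest_point_dot[OF assms(2,1)] metric_proj_closest[OF assms(1,2)] assms(3) by blast

text \<open>
  This is the variational inequality \<open>\<langle>p - x, p\<rangle> \<le> \<langle>p - x, a\<rangle>\<close>, with the left-hand side expanded
  by polarization so that it telescopes along an orbit.
\<close>

lemma metric_proj_step:
  fixes S :: "'a::{real_inner, complete_space} set"
  assumes "closed S" "convex S" "a \<in> S"
  shows "(norm (metric_proj S x))\<^sup>2 - (norm x)\<^sup>2 + (norm (metric_proj S x - x))\<^sup>2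
           \<le> 2 * inner (metric_proj S x - x) a"
proof -
  define p where "p = metric_proj S x"
  have "inner (x - p) (a - p) \<le> 0"
    using metric_proj_inner_le_0[OF assms] by (simp add: p_def)
  then show ?thesis
    unfolding p_def[symmetric] power2_norm_eq_inner
    by (simp add: inner_simps inner_commute algebra_simps)
qed

section \<open>Weak convergence\<close>

lemma weakly_converges_subseq:
  assumes "weakly_converges x w" "strict_mono r"
  shows "weakly_converges (x \<circ> r) w"
  using assms LIMSEQ_subseq_LIMSEQ[of _ _ r] unfolding weakly_converges_def by (fastforce simp: o_def)

text \<open>
  Let \<open>p\<close> be the point of \<open>S\<close> nearest to \<open>w\<close>. By the variational inequality the half-space
  \<open>{v. \<langle>v - p, w - p\<rangle> \<le> 0}\<close> contains \<open>S\<close>, hence the sequence and its weak limit \<open>w\<close>, which forces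
  \<open>w = p\<close>.
\<close>

lemma weak_limit_in_closed_convex:
  fixes S :: "'a::{real_inner, complete_space} set"
  assumes "closed S" "convex S" "weakly_converges x w" "\<And>n. x n \<in> S"
  shows "w \<in> S"
proof -
  define p where "p = metric_proj S w"
  have "(\<lambda>n. inner (x n) (w - p)) \<longlonglongrightarrow> inner w (w - p)"
    using assms(3) by (simp add: weakly_converges_def)
  moreover have "inner (x n) (w - p) \<le> inner p (w - p)" for n
    using metric_proj_inner_le_0[OF assms(1,2,4), of w n]
    by (simp add: p_def inner_diff_right inner_diff_left inner_commute)
  ultimately have "inner w (w - p) \<le> inner p (w - p)"
    by (intro LIMSEQ_le_const2) auto
  then have "inner (w - p) (w - p) \<le> 0"
    by (simp add: inner_diff_left)
  then have "w = p"
    by (metis inner_gt_zero_iff not_less right_minus_eq)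
  then show ?thesis
    using metric_proj_in[OF assms(1,2)] assms(4) unfolding p_def by (metis empty_iff)
qed

text \<open>
  The only possible weak limit is a common point of the closed convex hulls of the tails, so such
  a point is the limit as soon as all the scalar sequences converge.
\<close>

lemma weakly_converges_if_inner_convergent:
  fixes s :: "nat \<Rightarrow> 'a::{real_inner, complete_space}"
  assumes bounded: "\<And>n. norm (s n) \<le> B" and conv: "\<And>y. convergent (\<lambda>n. inner (s n) y)"
  obtains w where "weakly_converges s w"
proof -
  define C where "C n = closure (convex hull (s ` {n..}))" for n
  have in_C: "s k \<in> C n" if "n \<le> k" for n k
    unfolding C_def using that by (intro subsetD[OF closure_subset] hull_inc) auto
  obtain w where w: "\<And>n. w \<in> C n"
  proof (rule nearest_point_of_nested_convex[of C 0 B])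
    show "closed (C n)" "convex (C n)" for n
      by (simp_all add: C_def convex_closure convex_convex_hull)
    show "C n \<noteq> {}" for n
      using in_C by blast
    show "C n \<subseteq> C m" if "m \<le> n" for m n
      unfolding C_def using that by (intro closure_mono hull_mono) auto
    show "infdist 0 (C n) \<le> B" for n
      using infdist_le[OF in_C[of n n], of 0] bounded[of n] by auto
  qed blast
  have "(\<lambda>n. inner (s n) y) \<longlonglongrightarrow> inner w y" for y
  proof -
    obtain L where L: "(\<lambda>n. inner (s n) y) \<longlonglongrightarrow> L"
      using conv by (auto simp: convergent_def)
    have "\<bar>inner w y - L\<bar> \<le> e" if "e > 0" for e
    proof -
      obtain N where N: "\<And>n. n \<ge> N \<Longrightarrow> \<bar>inner (s n) y - L\<bar> < e"
        using LIMSEQ_D[OF L \<open>e > 0\<close>] by auto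
      define T where "T = {v. inner y v \<le> L + e} \<inter> {v. inner y v \<ge> L - e}"
      have "closed T" "convex T"
        unfolding T_def
        by (simp_all add: closed_Int closed_halfspace_le closed_halfspace_ge convex_Int
            convex_halfspace_le convex_halfspace_ge)
      moreover have "s ` {N..} \<subseteq> T"
        using N by (fastforce simp: T_def inner_commute abs_less_iff)
      ultimately have "C N \<subseteq> T"
        unfolding C_def by (intro closure_minimal hull_minimal)
      then show ?thesis
        using w[of N] by (auto simp: T_def inner_commute abs_le_iff)
    qed
    then have "\<bar>inner w y - L\<bar> \<le> 0"
      by (rule field_le_epsilon) simp
    then show ?thesis
      using L by simp
  qed
  then show thesis
    using that unfolding weakly_converges_def by blast
qed

text \<open>
  Along a diagonal subsequence, the inner products with every member of the sequence converge. The
  vectors \<open>y\<close> whose inner products converge form a closed subspace \<open>D\<close>, and \<open>D\<close> is the whole space: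
  the difference between \<open>y\<close> and its projection onto \<open>D\<close> is orthogonal to \<open>D\<close>, in particular
  to the sequence itself, so \<open>y\<close> has the same inner products as its projection.
\<close>

proposition bounded_weakly_convergent_subsequence:
  fixes x :: "nat \<Rightarrow> 'a::{real_inner, complete_space}"
  assumes bounded: "\<And>n. norm (x n) \<le> B"
  obtains r w where "strict_mono (r :: nat \<Rightarrow> nat)" "weakly_converges (x \<circ> r) w"
proof -
  interpret subseqs "\<lambda>j s. convergent (\<lambda>n. inner (x (s n)) (x j))"
  proof
    fix j and s :: "nat \<Rightarrow> nat"
    have "\<bar>inner (x (s n)) (x j)\<bar> \<le> B * norm (x j)" for n
      by (rule order_trans[OF Cauchy_Schwarz_ineq2]) (simp add: bounded mult_right_mono)
    then have "Bseq (\<lambda>n. inner (x (s n)) (x j))"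
      by (intro BseqI') auto
    then obtain r l where "strict_mono r" "(\<lambda>n. inner (x (s (r n))) (x j)) \<longlonglongrightarrow> l"
      using bounded_imp_convergent_subsequence[of "\<lambda>n. inner (x (s n)) (x j)"]
      by (auto simp: Bseq_eq_bounded o_def)
    then show "\<exists>r. strict_mono r \<and> convergent (\<lambda>n. inner (x ((s \<circ> r) n)) (x j))"
      by (auto simp: convergent_def)
  qed
  define s where "s = x \<circ> diagseq"
  have s_bounded: "norm (s n) \<le> B" for n
    by (simp add: s_def bounded)
  have B: "B \<ge> 0"
    using bounded[of 0] norm_ge_zero order_trans by blast
  define D where "D = {y. convergent (\<lambda>n. inner (s n) y)}"
  have "x j \<in> D" for j
  proof -
    have "convergent (\<lambda>n. inner (x ((diagseq \<circ> (+) (Suc j)) n)) (x j))"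
    proof (rule diagseq_holds)
      fix r t :: "nat \<Rightarrow> nat" and k
      assume "strict_mono r" "convergent (\<lambda>n. inner (x (t n)) (x k))"
      then show "convergent (\<lambda>n. inner (x ((t \<circ> r) n)) (x k))"
        using convergent_subseq_convergent[of "\<lambda>n. inner (x (t n)) (x k)" r] by (simp add: o_def)
    qed
    then have "convergent (\<lambda>n. inner (s (n + Suc j)) (x j))"
      by (simp add: s_def add.commute)
    then show ?thesis
      using convergent_ignore_initial_segment[of "\<lambda>n. inner (s n) (x j)" "Suc j"]
      by (simp add: D_def)
  qed
  then have s_D: "s n \<in> D" for n
    by (simp add: s_def)
  have lin_D: "a *\<^sub>R u + b *\<^sub>R v \<in> D" if "u \<in> D" "v \<in> D" for a b u v
  proof -
    have "convergent (\<lambda>n. a * inner (s n) u + b * inner (s n) v)"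
      using that by (intro convergent_add convergent_mult convergent_const) (simp_all add: D_def)
    then show ?thesis
      by (simp add: D_def inner_simps)
  qed
  then have "convex D"
    by (simp add: convex_def)
  moreover have "closed D"
    unfolding closed_sequential_limits
  proof safe
    fix y l assume y: "\<forall>n. y n \<in> D" and l: "y \<longlonglongrightarrow> l"
    have "Cauchy (\<lambda>n. inner (s n) l)"
    proof (rule metric_CauchyI)
      fix e :: real assume "e > 0"
      define c where "c = e / (3 * (B + 1))"
      have "c > 0"
        using \<open>e > 0\<close> B by (simp add: c_def)
      then obtain k where k: "norm (y k - l) < c"
        using LIMSEQ_D[OF l] by blast
      have close: "\<bar>inner (s n) (y k) - inner (s n) l\<bar> < e / 3" for n
      proof -
        have "\<bar>inner (s n) (y k - l)\<bar> \<le> norm (s n) * norm (y k - l)"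
          by (rule Cauchy_Schwarz_ineq2)
        also have "\<dots> \<le> B * c"
          using k s_bounded B by (intro mult_mono) auto
        also have "\<dots> < (B + 1) * c"
          using \<open>c > 0\<close> by (simp add: distrib_right)
        also have "\<dots> = e / 3"
          using B by (simp add: c_def field_simps)
        finally show ?thesis
          by (simp add: inner_diff_right)
      qed
      have "Cauchy (\<lambda>n. inner (s n) (y k))"
        using y by (simp add: D_def Cauchy_convergent_iff)
      then obtain M where M: "\<And>m n. m \<ge> M \<Longrightarrow> n \<ge> M \<Longrightarrow>
          dist (inner (s m) (y k)) (inner (s n) (y k)) < e / 3"
        using metric_CauchyD[of _ "e / 3"] \<open>e > 0\<close> by (metis divide_pos_pos zero_less_numeral)
      then have "dist (inner (s m) l) (inner (s n) l) < e" if "m \<ge> M" "n \<ge> M" for m n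
        using M[OF that] close[of m] close[of n] unfolding dist_real_def by linarith
      then show "\<exists>M. \<forall>m\<ge>M. \<forall>n\<ge>M. dist (inner (s m) l) (inner (s n) l) < e"
        by blast
    qed
    then show "l \<in> D"
      by (simp add: D_def Cauchy_convergent_iff)
  qed
  ultimately have proj: "metric_proj D y \<in> D"
      "\<And>a. a \<in> D \<Longrightarrow> inner (y - metric_proj D y) (a - metric_proj D y) \<le> 0" for y
    using s_D by (auto intro: metric_proj_in metric_proj_inner_le_0)
  have "y \<in> D" for y
  proof -
    define p where "p = metric_proj D y"
    have "inner (s n) y = inner (s n) p" for n
    proof -
      (* Both p + s n and p - s n lie in D; together they turn the inequality into orthogonality. *)
      have "p + s n \<in> D" "p - s n \<in> D"
        using lin_D[of p "s n" 1 1] lin_D[of p "s n" 1 "-1"] s_D proj(1) by (auto simp: p_def)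
      then have "inner (y - p) (s n) \<le> 0" "inner (y - p) (- s n) \<le> 0"
        using proj(2)[of "p + s n" y] proj(2)[of "p - s n" y] by (simp_all add: p_def)
      then show ?thesis
        by (simp add: inner_simps inner_commute)
    qed
    then show ?thesis
      using proj(1)[of y] by (simp add: D_def p_def)
  qed
  then have "convergent (\<lambda>n. inner (s n) y)" for y
    by (simp add: D_def)
  then obtain w where "weakly_converges s w"
    using weakly_converges_if_inner_convergent[of s B] s_bounded by blast
  then show thesis
    using that subseq_diagseq by (simp add: s_def)
qed

section \<open>Oscillation between two weak limits\<close>

text \<open>
  Infinitely many disjoint excursions of the sequence \<open>x\<close>, from near \<open>w\<close> at times \<open>n k\<close> to near
  \<open>w'\<close> at times \<open>m k\<close>, that use only indices in \<open>I\<close> strictly in between.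
\<close>

definition oscillates ::
  "(nat \<Rightarrow> 'a::real_inner) \<Rightarrow> (nat \<Rightarrow> nat) \<Rightarrow> nat set \<Rightarrow> 'a \<Rightarrow> 'a \<Rightarrow> (nat \<Rightarrow> nat) \<Rightarrow> (nat \<Rightarrow> nat) \<Rightarrow> bool"
where
  "oscillates x i I w w' n m \<longleftrightarrow>
     (\<forall>k. n k < m k \<and> m k < n (Suc k)) \<and>
     weakly_converges (x \<circ> n) w \<and> weakly_converges (x \<circ> m) w' \<and>
     (\<forall>k. i ` {n k<..<m k} \<subseteq> I)"

lemma strict_mono_interleaved:
  fixes n m :: "nat \<Rightarrow> nat"
  assumes "\<And>k. n k < m k \<and> m k < n (Suc k)"
  shows "strict_mono n" "strict_mono m"
  using assms by (meson less_trans strict_mono_Suc_iff)+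

lemma interleaved_subseq:
  fixes n m r :: "nat \<Rightarrow> nat"
  assumes "\<And>k. n k < m k \<and> m k < n (Suc k)" "strict_mono r"
  shows "(n \<circ> r) k < (m \<circ> r) k" "(m \<circ> r) k < (n \<circ> r) (Suc k)"
proof -
  have "n (Suc (r k)) \<le> n (r (Suc k))"
    using strict_mono_interleaved(1)[of n m] assms
    by (metis Suc_leI lessI strict_mono_less strict_mono_less_eq)
  then show "(n \<circ> r) k < (m \<circ> r) k" "(m \<circ> r) k < (n \<circ> r) (Suc k)"
    using assms(1)[of "r k"] by auto
qed

lemma oscillates_subseq:
  assumes "oscillates x i I w w' n m" "strict_mono r"
  shows "oscillates x i I w w' (n \<circ> r) (m \<circ> r)"
  using assms interleaved_subseq[of n m r] weakly_converges_subseq[of "x \<circ> n" w r]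
    weakly_converges_subseq[of "x \<circ> m" w' r]
  unfolding oscillates_def by (auto simp: o_assoc)

lemma partial_weak_limits_oscillate:
  assumes "w \<in> partial_weak_limits x" "w' \<in> partial_weak_limits x"
  obtains n m where "oscillates x i (range i) w w' n m"
proof -
  obtain r r' where r: "strict_mono r" "weakly_converges (x \<circ> r) w"
    and r': "strict_mono r'" "weakly_converges (x \<circ> r') w'"
    using assms by (auto simp: partial_weak_limits_def)
  (* Since r t and r' t are at least t, evaluating at the successor of the last time moves past it. *)
  define p where "p = rec_nat 0 (\<lambda>_ t. Suc (r' (Suc (r t))))"
  have p_Suc: "p (Suc k) = Suc (r' (Suc (r (p k))))" for k
    by (simp add: p_def)
  define q where "q k = Suc (r (p k))" for k
  have step: "r (p k) < r' (q k)" "r' (q k) < r (p (Suc k))" for k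
    using seq_suble[OF r'(1), of "q k"] seq_suble[OF r(1), of "p (Suc k)"]
    by (simp_all add: p_Suc q_def)
  have p_mono: "strict_mono p"
    using less_trans[OF step] strict_mono_less[OF r(1)] by (simp add: strict_mono_Suc_iff)
  then have q_mono: "strict_mono q"
    using strict_mono_less[OF r(1)] by (simp add: q_def strict_mono_def)
  then have "oscillates x i (range i) w w' (r \<circ> p) (r' \<circ> q)"
    using step weakly_converges_subseq[OF r(2) p_mono] weakly_converges_subseq[OF r'(2) q_mono]
    by (auto simp: oscillates_def o_assoc)
  then show thesis
    using that by blast
qed

lemma oscillates_imp_partial_weak_limits:
  assumes "oscillates x i I w w' n m"
  shows "w \<in> partial_weak_limits x" "w' \<in> partial_weak_limits x"
  using assms strict_mono_interleaved[of n m]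
  unfolding oscillates_def partial_weak_limits_def by blast+

text \<open>
  Cutting every excursion at the first use of \<open>j\<close> removes \<open>j\<close> from the indices, and any weak limit
  of the cut points lies in the closed convex set that contains the points produced by \<open>j\<close>.
\<close>

lemma oscillates_cut_first:
  fixes S :: "'a::{real_inner, complete_space} set"
  assumes osc: "oscillates x i I w w' n m" and used: "\<And>k. j \<in> i ` {n k<..<m k}"
    and bounded: "\<And>l. norm (x l) \<le> B"
    and S: "closed S" "convex S" "\<And>l. l \<ge> 1 \<Longrightarrow> i l = j \<Longrightarrow> x l \<in> S"
  obtains v n' m' where "v \<in> S" "oscillates x i (I - {j}) w v n' m'"
proof -
  have nm: "n k < m k" "m k < n (Suc k)" "i ` {n k<..<m k} \<subseteq> I" for k
    using osc by (auto simp: oscillates_def)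
  define f where "f k = (LEAST l. n k < l \<and> i l = j)" for k
  have f: "n k < f k" "f k < m k" "i (f k) = j" "i ` {n k<..<f k} \<subseteq> I - {j}" for k
  proof -
    obtain l where l: "n k < l" "i l = j" "l < m k"
      using used[of k] by auto
    then show "n k < f k" "i (f k) = j"
      using LeastI[of "\<lambda>l. n k < l \<and> i l = j" l] by (auto simp: f_def)
    have le: "f k \<le> t" if "n k < t" "i t = j" for t
      using that Least_le[of "\<lambda>l. n k < l \<and> i l = j" t] by (auto simp: f_def)
    show "f k < m k"
      using le[of l] l by simp
    then show "i ` {n k<..<f k} \<subseteq> I - {j}"
      using nm(3)[of k] le by fastforce
  qed
  obtain r v where r: "strict_mono r" and v: "weakly_converges ((x \<circ> f) \<circ> r) v"
    using bounded_weakly_convergent_subsequence[of "x \<circ> f" B] bounded by auto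
  have "v \<in> S"
  proof (rule weak_limit_in_closed_convex[OF S(1,2) v])
    show "((x \<circ> f) \<circ> r) k \<in> S" for k
      using f(1)[of "r k"] f(3)[of "r k"] by (auto intro!: S(3))
  qed
  moreover have "oscillates x i (I - {j}) w v (n \<circ> r) (f \<circ> r)"
    unfolding oscillates_def
  proof (intro conjI allI)
    have "n k < f k \<and> f k < n (Suc k)" for k
      using f(1,2)[of k] nm(2)[of k] by simp
    then show "(n \<circ> r) k < (f \<circ> r) k" "(f \<circ> r) k < (n \<circ> r) (Suc k)" for k
      using interleaved_subseq[of n f r] r by blast+
    show "weakly_converges (x \<circ> (n \<circ> r)) w"
      using weakly_converges_subseq[of "x \<circ> n" w r] osc r by (simp add: oscillates_def o_assoc)
    show "weakly_converges (x \<circ> (f \<circ> r)) v"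
      using v by (simp add: o_assoc)
    show "i ` {(n \<circ> r) k<..<(f \<circ> r) k} \<subseteq> I - {j}" for k
      using f(4)[of "r k"] by simp
  qed
  ultimately show thesis
    using that by blast
qed

lemma oscillates_cut_last:
  fixes S :: "'a::{real_inner, complete_space} set"
  assumes osc: "oscillates x i I w w' n m" and used: "\<And>k. j \<in> i ` {n k<..<m k}"
    and bounded: "\<And>l. norm (x l) \<le> B"
    and S: "closed S" "convex S" "\<And>l. l \<ge> 1 \<Longrightarrow> i l = j \<Longrightarrow> x l \<in> S"
  obtains v n' m' where "v \<in> S" "oscillates x i (I - {j}) v w' n' m'"
proof -
  have nm: "n k < m k" "m k < n (Suc k)" "i ` {n k<..<m k} \<subseteq> I" for k
    using osc by (auto simp: oscillates_def)
  define f where "f k = (GREATEST l. l < m k \<and> i l = j)" for k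
  have f: "n k < f k" "f k < m k" "i (f k) = j" "i ` {f k<..<m k} \<subseteq> I - {j}" for k
  proof -
    obtain l where l: "n k < l" "i l = j" "l < m k"
      using used[of k] by auto
    then show "f k < m k" "i (f k) = j"
      using GreatestI_nat[of "\<lambda>l. l < m k \<and> i l = j" l "m k"] by (auto simp: f_def)
    have le: "t \<le> f k" if "t < m k" "i t = j" for t
      using that Greatest_le_nat[of "\<lambda>l. l < m k \<and> i l = j" t "m k"] by (auto simp: f_def)
    show "n k < f k"
      using le[of l] l by simp
    then show "i ` {f k<..<m k} \<subseteq> I - {j}"
      using nm(3)[of k] le by fastforce
  qed
  obtain r v where r: "strict_mono r" and v: "weakly_converges ((x \<circ> f) \<circ> r) v"
    using bounded_weakly_convergent_subsequence[of "x \<circ> f" B] bounded by auto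
  have "v \<in> S"
  proof (rule weak_limit_in_closed_convex[OF S(1,2) v])
    show "((x \<circ> f) \<circ> r) k \<in> S" for k
      using f(1)[of "r k"] f(3)[of "r k"] by (auto intro!: S(3))
  qed
  moreover have "oscillates x i (I - {j}) v w' (f \<circ> r) (m \<circ> r)"
    unfolding oscillates_def
  proof (intro conjI allI)
    have "f k < m k \<and> m k < f (Suc k)" for k
      using f(1)[of "Suc k"] f(2)[of k] nm(2)[of k] by simp
    then show "(f \<circ> r) k < (m \<circ> r) k" "(m \<circ> r) k < (f \<circ> r) (Suc k)" for k
      using interleaved_subseq[of f m r] r by blast+
    show "weakly_converges (x \<circ> (m \<circ> r)) w'"
      using weakly_converges_subseq[of "x \<circ> m" w' r] osc r by (simp add: oscillates_def o_assoc)
    show "weakly_converges (x \<circ> (f \<circ> r)) v"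
      using v by (simp add: o_assoc)
    show "i ` {(f \<circ> r) k<..<(m \<circ> r) k} \<subseteq> I - {j}" for k
      using f(4)[of "r k"] by simp
  qed
  ultimately show thesis
    using that by blast
qed

text \<open>
  The oscillation with the fewest indices works. If one of its indices were used in only finitely
  many excursions, dropping these would remove the index; otherwise it is used in every excursion
  of a suitable subsequence, and both ways of cutting apply.
\<close>

lemma oscillation_through_common_sets:
  fixes A :: "nat \<Rightarrow> 'a::{real_inner, complete_space} set"
  assumes "w0 \<in> partial_weak_limits x" "w0' \<in> partial_weak_limits x" "w0 \<noteq> w0'"
    and finite: "finite (range i)"
    and bounded: "\<And>l. norm (x l) \<le> B"
    and A: "\<And>l. l \<ge> 1 \<Longrightarrow> closed (A (i l)) \<and> convex (A (i l)) \<and> x l \<in> A (i l)"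
  obtains I w w' n m where "w \<noteq> w'" "oscillates x i I w w' n m"
    "\<And>j. j \<in> I \<Longrightarrow> w \<in> A j \<and> w' \<in> A j"
proof -
  define Q where "Q c I \<longleftrightarrow>
    finite I \<and> card I = c \<and> (\<exists>w w' n m. w \<noteq> w' \<and> oscillates x i I w w' n m)" for c I
  have "\<exists>c I. Q c I"
    using partial_weak_limits_oscillate[OF assms(1,2)] assms(3) finite unfolding Q_def by metis
  then obtain c where "\<exists>I. Q c I" and least: "\<And>c'. c' < c \<Longrightarrow> \<not> (\<exists>I. Q c' I)"
    using exists_least_iff[of "\<lambda>c. \<exists>I. Q c I"] by blast
  then obtain I w w' n m where I: "finite I" "card I = c" and ww: "w \<noteq> w'"
    and osc: "oscillates x i I w w' n m"
    unfolding Q_def by blast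
  have minimal: "u = u'" if "j \<in> I" "oscillates x i (I - {j}) u u' n' m'" for j u u' n' m'
  proof (rule ccontr)
    assume "u \<noteq> u'"
    with that(2) I(1) have "Q (card (I - {j})) (I - {j})"
      unfolding Q_def by auto
    moreover have "card (I - {j}) < c"
      using that I by (metis card_Diff1_less)
    ultimately show False
      using least by blast
  qed
  have "w \<in> A j \<and> w' \<in> A j" if j: "j \<in> I" for j
  proof -
    define U where "U = {k. j \<in> i ` {n k<..<m k}}"
    have "infinite U"
    proof
      assume "finite U"
      then obtain N where N: "\<And>k. k \<in> U \<Longrightarrow> k < N"
        unfolding finite_nat_set_iff_bounded by blast
      have "strict_mono (\<lambda>k. k + N)"
        by (simp add: strict_mono_def)
      then have "oscillates x i I w w' (n \<circ> (\<lambda>k. k + N)) (m \<circ> (\<lambda>k. k + N))"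
        by (rule oscillates_subseq[OF osc])
      moreover have "j \<notin> i ` {n (k + N)<..<m (k + N)}" for k
        using N[of "k + N"] by (auto simp: U_def)
      ultimately have "oscillates x i (I - {j}) w w' (n \<circ> (\<lambda>k. k + N)) (m \<circ> (\<lambda>k. k + N))"
        unfolding oscillates_def by (simp add: subset_Diff_insert)
      then show False
        using minimal[OF j] ww by blast
    qed
    then obtain r :: "nat \<Rightarrow> nat" where r: "strict_mono r" "\<And>k. r k \<in> U"
      using infinite_enumerate by blast
    have osc': "oscillates x i I w w' (n \<circ> r) (m \<circ> r)"
      by (rule oscillates_subseq[OF osc r(1)])
    have used: "j \<in> i ` {(n \<circ> r) k<..<(m \<circ> r) k}" for k
      using r(2)[of k] by (simp add: U_def)
    (* The interval is open, so the times in question are positive although n 0 may be 0. *)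
    obtain l where "l \<ge> 1" "i l = j"
    proof -
      obtain l where "n (r 0) < l" "i l = j"
        using used[of 0] by auto
      then show thesis
        using that[of l] by simp
    qed
    then have Aj: "closed (A j)" "convex (A j)"
      using A[of l] by simp_all
    have produced: "\<And>l. l \<ge> 1 \<Longrightarrow> i l = j \<Longrightarrow> x l \<in> A j"
      using A by blast
    obtain v n' m' where "v \<in> A j" "oscillates x i (I - {j}) w v n' m'"
      using oscillates_cut_first[OF osc' used bounded Aj produced] .
    moreover obtain v' l' k' where "v' \<in> A j" "oscillates x i (I - {j}) v' w' l' k'"
      using oscillates_cut_last[OF osc' used bounded Aj produced] .
    ultimately show ?thesis
      using minimal[OF j] by metis
  qed
  then show thesis
    using that ww osc by blast
qed

section \<open>Orbits of successive projections\<close>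

locale projection_orbit =
  fixes A :: "nat \<Rightarrow> 'a::{real_inner, complete_space} set" and i :: "nat \<Rightarrow> nat" and x :: "nat \<Rightarrow> 'a"
  assumes set: "l \<ge> 1 \<Longrightarrow> closed (A (i l)) \<and> convex (A (i l)) \<and> 0 \<in> A (i l)"
    and orbit: "l \<ge> 1 \<Longrightarrow> x l = metric_proj (A (i l)) (x (l - 1))"
begin

lemma orbit_in_set:
  assumes "l \<ge> 1"
  shows "x l \<in> A (i l)"
  using set[OF assms] orbit[OF assms] metric_proj_in by (metis empty_iff)

lemma orbit_step:
  assumes "a \<in> A (i (Suc l))"
  shows "(norm (x (Suc l)))\<^sup>2 - (norm (x l))\<^sup>2 + (norm (x (Suc l) - x l))\<^sup>2
           \<le> 2 * inner (x (Suc l) - x l) a"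
  using metric_proj_step[of "A (i (Suc l))" a "x l"] set[of "Suc l"] orbit[of "Suc l"] assms
  by simp

lemma norm_sq_decreasing:
  "(norm (x (Suc l)))\<^sup>2 + (norm (x (Suc l) - x l))\<^sup>2 \<le> (norm (x l))\<^sup>2"
  using orbit_step[of 0 l] set[of "Suc l"] by simp

lemma decseq_norm_sq: "decseq (\<lambda>l. (norm (x l))\<^sup>2)"
  unfolding decseq_Suc_iff using norm_sq_decreasing by (smt (verit) zero_le_power2)

lemma norm_le_initial: "norm (x l) \<le> norm (x 0)"
  using decseqD[OF decseq_norm_sq, of 0 l] by simp

lemma norm_sq_convergent: obtains L where "(\<lambda>l. (norm (x l))\<^sup>2) \<longlonglongrightarrow> L"
  using decseq_convergent[OF decseq_norm_sq, of 0] by auto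

lemma steps_tend_to_0: "(\<lambda>l. x (Suc l) - x l) \<longlonglongrightarrow> 0"
proof -
  obtain L where L: "(\<lambda>l. (norm (x l))\<^sup>2) \<longlonglongrightarrow> L"
    using norm_sq_convergent .
  have drop: "(\<lambda>l. (norm (x l))\<^sup>2 - (norm (x (Suc l)))\<^sup>2) \<longlonglongrightarrow> 0"
    using tendsto_diff[OF L LIMSEQ_Suc[OF L]] by simp
  have "(\<lambda>l. (norm (x (Suc l) - x l))\<^sup>2) \<longlonglongrightarrow> 0"
  proof (rule tendsto_sandwich[OF _ _ tendsto_const drop])
    show "\<forall>\<^sub>F l in sequentially.
        (norm (x (Suc l) - x l))\<^sup>2 \<le> (norm (x l))\<^sup>2 - (norm (x (Suc l)))\<^sup>2"
      using norm_sq_decreasing by (auto intro!: always_eventually simp: algebra_simps)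
  qed simp
  then have "(\<lambda>l. sqrt ((norm (x (Suc l) - x l))\<^sup>2)) \<longlonglongrightarrow> sqrt 0"
    by (rule tendsto_real_sqrt)
  then show ?thesis
    by (simp add: tendsto_norm_zero_iff)
qed

lemma norm_sq_change_along_excursion:
  assumes "n \<le> p" and "\<And>l. n < l \<Longrightarrow> l \<le> p \<Longrightarrow> a \<in> A (i l)"
  shows "(norm (x p))\<^sup>2 - (norm (x n))\<^sup>2 \<le> 2 * inner (x p - x n) a"
  using assms
proof (induction p rule: dec_induct)
  case base
  show ?case by simp
next
  case (step p)
  have "(norm (x p))\<^sup>2 - (norm (x n))\<^sup>2 \<le> 2 * inner (x p - x n) a"
    using step by simp
  moreover have "(norm (x (Suc p)))\<^sup>2 - (norm (x p))\<^sup>2 \<le> 2 * inner (x (Suc p) - x p) a"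
    using orbit_step[of a p] step by (smt (verit) zero_le_power2 le_imp_less_Suc order_refl)
  ultimately show ?case
    by (simp add: inner_diff_left)
qed

text \<open>
  The inequality \<open>norm_sq_change_along_excursion\<close> is passed to the limit along the excursions. The
  last point \<open>x (m k)\<close> of an excursion may be produced by an index outside \<open>I\<close>, so the summation
  stops at the point before, which has the same weak limit because the steps tend to \<open>0\<close>.
\<close>

lemma oscillates_inner_nonneg:
  assumes osc: "oscillates x i I w w' n m" and a: "\<And>j. j \<in> I \<Longrightarrow> a \<in> A j"
  shows "inner (w' - w) a \<ge> 0"
proof -
  have nm: "n k < m k" "m k < n (Suc k)" "i ` {n k<..<m k} \<subseteq> I"
    and w: "weakly_converges (x \<circ> n) w" and w': "weakly_converges (x \<circ> m) w'" for k
    using osc by (auto simp: oscillates_def)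
  define p where "p k = m k - 1" for k
  have m_eq: "m k = Suc (p k)" for k
    using nm(1)[of k] by (simp add: p_def)
  have mono: "strict_mono n" "strict_mono p"
    using strict_mono_interleaved[of n m] nm m_eq by (auto simp: strict_mono_def)
  obtain L where L: "(\<lambda>l. (norm (x l))\<^sup>2) \<longlonglongrightarrow> L"
    using norm_sq_convergent .
  have lower: "(\<lambda>k. (norm (x (p k)))\<^sup>2 - (norm (x (n k)))\<^sup>2) \<longlonglongrightarrow> L - L"
    using LIMSEQ_subseq_LIMSEQ[OF L mono(1)] LIMSEQ_subseq_LIMSEQ[OF L mono(2)]
    by (intro tendsto_diff) (simp_all add: o_def)
  have "(\<lambda>k. x (m k) - x (p k)) \<longlonglongrightarrow> 0"
    using LIMSEQ_subseq_LIMSEQ[OF steps_tend_to_0 mono(2)] by (simp add: o_def m_eq)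
  then have "(\<lambda>k. inner (x (m k) - x (p k)) a) \<longlonglongrightarrow> inner 0 a"
    by (intro tendsto_intros)
  moreover have "(\<lambda>k. inner (x (m k)) a) \<longlonglongrightarrow> inner w' a"
    using w' by (simp add: weakly_converges_def o_def)
  moreover have "(\<lambda>k. inner (x (n k)) a) \<longlonglongrightarrow> inner w a"
    using w by (simp add: weakly_converges_def o_def)
  ultimately have "(\<lambda>k. 2 * (inner (x (m k)) a - inner (x (m k) - x (p k)) a - inner (x (n k)) a))
      \<longlonglongrightarrow> 2 * (inner w' a - inner 0 a - inner w a)"
    by (intro tendsto_mult_left tendsto_diff)
  then have upper: "(\<lambda>k. 2 * inner (x (p k) - x (n k)) a) \<longlonglongrightarrow> 2 * inner (w' - w) a"
    by (simp add: inner_diff_left)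
  have "(norm (x (p k)))\<^sup>2 - (norm (x (n k)))\<^sup>2 \<le> 2 * inner (x (p k) - x (n k)) a" for k
  proof (rule norm_sq_change_along_excursion)
    show "n k \<le> p k"
      using nm(1)[of k] m_eq[of k] by simp
    show "a \<in> A (i l)" if "n k < l" "l \<le> p k" for l
      using that nm(3)[of k] m_eq[of k] by (intro a) auto
  qed
  then have "L - L \<le> 2 * inner (w' - w) a"
    by (intro LIMSEQ_le[OF lower upper]) blast
  then show ?thesis
    by simp
qed

lemma partial_weak_limit_in_set:
  assumes "infinite {l. l \<ge> 1 \<and> i l = k}"
  obtains w where "w \<in> partial_weak_limits x" "w \<in> A k"
proof -
  obtain s :: "nat \<Rightarrow> nat" where s: "strict_mono s" "\<And>l. s l \<ge> 1 \<and> i (s l) = k"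
    using infinite_enumerate[OF assms] by blast
  obtain r w where r: "strict_mono r" and w: "weakly_converges ((x \<circ> s) \<circ> r) w"
    using bounded_weakly_convergent_subsequence[of "x \<circ> s" "norm (x 0)"] norm_le_initial by auto
  have "w \<in> partial_weak_limits x"
    using w s(1) r strict_mono_o[of s r] by (auto simp: partial_weak_limits_def o_assoc)
  moreover have "w \<in> A k"
    using set[of "s 0"] s(2) orbit_in_set
    by (intro weak_limit_in_closed_convex[OF _ _ w]) (force simp: o_def)+
  ultimately show thesis
    using that by blast
qed

end

theorem theorem2:
  fixes K :: nat
    and A :: "nat \<Rightarrow> 'a::{real_inner, complete_space} set"
    and i :: "nat \<Rightarrow> nat"
    and x :: "nat \<Rightarrow> 'a"
    and W :: "'a set"
    and J :: "'a \<Rightarrow> nat set"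
  defines "W \<equiv> partial_weak_limits x"
    and "J \<equiv> index_set K A"
  assumes "K \<ge> 2"
    and "\<And>k. k \<in> {1..K} \<Longrightarrow> closed (A k)"
    and "\<And>k. k \<in> {1..K} \<Longrightarrow> convex (A k)"
    and "(\<Inter>k\<in>{1..K}. A k) = {0}"
    and "\<And>n. n \<ge> 1 \<Longrightarrow> i n \<in> {1..K}"
    and "\<And>k. k \<in> {1..K} \<Longrightarrow> infinite {n. n \<ge> 1 \<and> i n = k}"
    and "\<And>n. n \<ge> 1 \<Longrightarrow> x n = metric_proj (A (i n)) (x (n - 1))"
    and "W \<noteq> {0}"
  shows "\<exists>w\<in>W. \<exists>w'\<in>W. w \<noteq> w' \<and>
    (\<exists>n m :: nat \<Rightarrow> nat.
        (\<forall>k. n k < m k \<and> m k < n (Suc k)) \<and>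
        weakly_converges (x \<circ> n) w \<and> weakly_converges (x \<circ> m) w' \<and>
        (\<forall>l \<in> (\<Union>k. {n k<..<m k}). i l \<in> J w \<inter> J w')) \<and>
    (\<forall>a \<in> (\<Inter>j\<in>J w. A j). inner (w' - w) a \<ge> 0) \<and>
    (\<forall>b \<in> (\<Inter>j\<in>J w'. A j). inner (w' - w) b \<ge> 0)"
proof -
  have zero: "0 \<in> A k" if "k \<in> {1..K}" for k
    using that assms(6) by blast
  interpret projection_orbit A i x
    using assms(4,5,7,9) zero by unfold_locales auto
  have meets: "\<exists>w\<in>W. w \<in> A k" if "k \<in> {1..K}" for k
    using partial_weak_limit_in_set[OF assms(8)[OF that]] unfolding W_def by blast
  have "\<exists>u\<in>W. \<exists>v\<in>W. u \<noteq> v"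
  proof (rule ccontr)
    assume single: "\<not> ?thesis"
    obtain u where u: "u \<in> W"
      using meets[of 1] assms(3) by auto
    have "u \<in> A k" if "k \<in> {1..K}" for k
      using meets[OF that] single u by metis
    then have "u = 0"
      using assms(6) by blast
    then have "W = {0}"
      using single u by auto
    then show False
      using assms(10) by simp
  qed
  then obtain w0 w0' where w0: "w0 \<in> W" "w0' \<in> W" "w0 \<noteq> w0'"
    by blast
  have "i l \<in> insert (i 0) {1..K}" for l
    using assms(7)[of l] by (cases l) auto
  then have "range i \<subseteq> insert (i 0) {1..K}"
    by blast
  then have "finite (range i)"
    using finite_subset by blast
  then obtain I w w' n m where ww: "w \<noteq> w'" and osc: "oscillates x i I w w' n m"
    and I: "\<And>j. j \<in> I \<Longrightarrow> w \<in> A j \<and> w' \<in> A j"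
    using oscillation_through_common_sets[of w0 x w0' i "norm (x 0)" A]
      w0 set orbit_in_set norm_le_initial unfolding W_def by metis
  (* The index i 0 belongs to no projection; all indices used inside excursions are genuine. *)
  define I' where "I' = I \<inter> {1..K}"
  have osc': "oscillates x i I' w w' n m"
    using osc assms(7) unfolding oscillates_def I'_def by fastforce
  have I': "I' \<subseteq> J w \<inter> J w'"
    using I by (auto simp: I'_def J_def index_set_def)
  show ?thesis
  proof (intro bexI conjI exI)
    show "w \<noteq> w'" by fact
    show "w \<in> W" "w' \<in> W"
      using oscillates_imp_partial_weak_limits[OF osc] by (simp_all add: W_def)
    show "\<forall>k. n k < m k \<and> m k < n (Suc k)" "weakly_converges (x \<circ> n) w"
        "weakly_converges (x \<circ> m) w'"
      using osc by (simp_all add: oscillates_def)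
    show "\<forall>l\<in>(\<Union>k. {n k<..<m k}). i l \<in> J w \<inter> J w'"
      using osc' I' unfolding oscillates_def by blast
    show "\<forall>a\<in>(\<Inter>j\<in>J w. A j). inner (w' - w) a \<ge> 0"
        "\<forall>b\<in>(\<Inter>j\<in>J w'. A j). inner (w' - w) b \<ge> 0"
      using I' by (auto intro!: oscillates_inner_nonneg[OF osc'])
  qed
qed

end
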